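(* Let $r\in\{1,\tfrac12,\tfrac13\}$ and let $I_1=I_{1/3}=\{0,1,2,4\}$ and $I_{1/2}=\{0,1,2,3\}$. For a nonempty subset $A\subseteq I_r$ let $\mathcal{C}_r(A)$ be the set of all $\alpha(\cdot,r)\in\mathcal{C}_r$ such that, for $k\in I_r$, the coefficient $d_k$ in the partial fractions decomposition of $\alpha(\cdot,r)$ is nonzero if and only if $k\in A$. For fixed $r$ the sets $\mathcal{C}_r(A)$ with distinct $A$ are disjoint, and: (i) For $r=1$, $\mathcal{C}_1(A)$ is nonempty for exactly the following 12 subsets $A$: $\{0,1,2,4\}$, $\{1,2,4\}$, $\{0,2,4\}$, $\{0,1,4\}$, $\{0,1,2\}$, $\{2,4\}$, $\{1,4\}$, $\{0,4\}$, $\{1,2\}$, $\{0,2\}$, $\{2\}$, $\{4\}$. (The sets $\mathcal{C}_1(\{0\})$, $\mathcal{C}_1(\{1\})$, $\mathcal{C}_1(\{0,1\})$ are excluded because their elements would satisfy $\alpha(1,1)=0$.) (ii) For $r=\tfrac13$, $\mathcal{C}_{1/3}(A)$ is nonempty for every nonempty subset $A$ of $\{0,1,2,4\}$; the three sets $\mathcal{C}_{1/3}(\{0\})$, $\mathcal{C}_{1/3}(\{1\})$, $\mathcal{C}_{1/3}(\{0,1\})$ are contained in $\mathcal{C}_0$, which leaves the 12 classes with $A=\{0,1,2,4\}$, $\{1,2,4\}$, $\{0,2,4\}$, $\{0,1,4\}$, $\{0,1,2\}$, $\{2,4\}$, $\{1,4\}$, $\{0,4\}$, $\{1,2\}$,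 $\{0,2\}$, $\{2\}$, $\{4\}$. (iii) For $r=\tfrac12$, $\mathcal{C}_{1/2}(A)$ is nonempty for every nonempty subset $A$ of $\{0,1,2,3\}$; the three sets $\mathcal{C}_{1/2}(\{0\})$, $\mathcal{C}_{1/2}(\{1\})$, $\mathcal{C}_{1/2}(\{0,1\})$ are contained in $\mathcal{C}_0$, which leaves the 12 classes with $A=\{0,1,2,3\}$, $\{1,2,3\}$, $\{0,2,3\}$, $\{0,1,3\}$, $\{0,1,2\}$, $\{2,3\}$, $\{1,3\}$, $\{0,3\}$, $\{1,2\}$, $\{0,2\}$, $\{2\}$, $\{3\}$.
   Context: Parameters: $v=(b_0,b_1,b_2,s_1,s_2)\in\mathbb{C}^5$ and $r\in\mathbb{C}$. Put $x_k=b_0+b_1k+b_2k(k-1)$ and $$\gamma(n,m,r)=\frac{(n-m+1)\bigl((nr-mr+1)x_{n-m}+(n-m)s_2+s_1\bigr)}{(2n-m-1)r+1},$$ $$\alpha(n,r)=\gamma(n,1,r)\Bigl(\tfrac12\bigl(\gamma(n,0,r)-2\gamma(n,1,r)+\gamma(n,2,r)\bigr)-(x_n-x_{n-1})\Bigr),$$ regarded as rational functions of $n$; in particular $\alpha(1,1)$ means the value at $n=1$ of the (reduced) rational function $\alpha(n,1)$. For $r\neq0$, $\mathcal{C}_r$ is the set of all rational functions $\alpha(\cdot,r)$ of $n$ obtained from parameter vectors $v$ with $(s_1+b_0)(s_2-rs_1)\neq0$ (equivalently $\alpha(1,r)\ne 0$). $\mathcal{C}_0$ is the set of all not identically zero polynomials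 in $n$ of the form $$\alpha(n,0)=n\bigl((n-1)b_2+s_2\bigr)\bigl((n^2-3n+2)b_2+(n-1)(b_1+s_2)+b_0+s_1\bigr),\qquad v\in\mathbb{C}^5 .$$ Partial fractions decomposition: for $r\ne0$, $$\alpha(n,r)=\frac{1}{256r^6}\,(d_0y_0+d_1y_1+d_2y_2+d_3y_3+d_4y_4),$$ where $$y_0=(4r^2n)^2(nr-2r+1)^2,\quad y_1=4r^3n(nr-2r+1),\quad y_2=1,$$ $$y_3=\frac{(r-1)(3r-1)}{(2nr-r+1)(2nr-3r+1)},\quad y_4=\frac{-(2r-1)^2}{(2nr-2r+1)^2},$$ and $d_0=b_2^2$, $d_1=p_1$, $d_3=p_2p_3$, $d_4=p_4^2$, $d_2=d_4-d_3$, with $$p_1=\bigl(b_2^2+8b_2(b_0+b_1)-4b_1^2\bigr)r^2+4b_2(2s_2+b_1-2b_2)r-2b_2^2,$$ $$p_2=(4b_0+2b_1-b_2)r^3+(8s_1+4s_2+4b_0-b_2)r^2+(b_2-4s_2-2b_1)r+b_2,$$ $$p_3=(2b_1-4b_0-3b_2)r^3+(8s_1-4s_2+4b_0-b_2)r^2+(3b_2-4s_2-2b_1)r+b_2,$$ $$p_4=(8s_1+4b_0)r^2+(2b_2-4s_2-2b_1)r+b_2.$$ For $r\in\{1,\frac13\}$ one has $y_3=0$ and $y_0,y_1,y_2,y_4$ are linearly independent; for $r=\frac12$ one has $y_4=0$ and $y_0,y_1,y_2,y_3$ are linearly independent. Hence the $d_k$ with $k\in I_r$ are determined by the function $\alpha(\cdot,r)$.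 *)

theory Defs
  imports "HOL-Computational_Algebra.Computational_Algebra"
begin

text \<open>
  Rational functions of \<open>n\<close> are elements of the fraction field of \<open>\<complex>[n]\<close>, so that equality of
  rational functions is equality of field elements; \<open>cst c\<close> is the constant \<open>c\<close> and \<open>\<nn>\<close> is the
  variable \<open>n\<close>.
\<close>

type_synonym ratfun = "complex poly fract"

definition cst :: "complex \<Rightarrow> ratfun" where
  "cst c = Fract [:c:] 1"

definition var_n :: ratfun  (\<open>\<nn>\<close>) where
  "\<nn> = Fract [:0, 1:] 1"

text \<open>The reduced form of \<open>f\<close> has no pole at \<open>a\<close> and takes the value \<open>c\<close> there.\<close>

definition has_value_at :: "ratfun \<Rightarrow> complex \<Rightarrow> complex \<Rightarrow> bool" where
  "has_value_at f a c \<longleftrightarrow>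
     (\<exists>p q. coprime p q \<and> f = Fract p q \<and> poly q a \<noteq> 0 \<and> c = poly p a / poly q a)"

datatype params = Params (b0: complex) (b1: complex) (b2: complex) (s1: complex) (s2: complex)

definition xseq :: "params \<Rightarrow> ratfun \<Rightarrow> ratfun" where
  "xseq v k = cst (b0 v) + cst (b1 v) * k + cst (b2 v) * k * (k - 1)"

definition gam :: "params \<Rightarrow> ratfun \<Rightarrow> ratfun \<Rightarrow> complex \<Rightarrow> ratfun" where
  "gam v n m r =
     (n - m + 1) *
       ((n * cst r - m * cst r + 1) * xseq v (n - m) + (n - m) * cst (s2 v) + cst (s1 v)) /
     ((2 * n - m - 1) * cst r + 1)"

definition alpha :: "params \<Rightarrow> complex \<Rightarrow> ratfun" where
  "alpha v r =
     gam v \<nn> 1 r *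
       (1/2 * (gam v \<nn> 0 r - 2 * gam v \<nn> 1 r + gam v \<nn> 2 r) - (xseq v \<nn> - xseq v (\<nn> - 1)))"

definition alpha_zero :: "params \<Rightarrow> ratfun" where
  "alpha_zero v =
     \<nn> * ((\<nn> - 1) * cst (b2 v) + cst (s2 v)) *
       ((\<nn>^2 - 3 * \<nn> + 2) * cst (b2 v) + (\<nn> - 1) * cst (b1 v + s2 v) + cst (b0 v + s1 v))"

definition admissible :: "params \<Rightarrow> complex \<Rightarrow> bool" where
  "admissible v r \<longleftrightarrow> (s1 v + b0 v) * (s2 v - r * s1 v) \<noteq> 0"

definition classC :: "complex \<Rightarrow> ratfun set"  (\<open>\<C>\<close>) where
  "\<C> r = (if r = 0 then {f. f \<noteq> 0 \<and> (\<exists>v. f = alpha_zero v)}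
          else {f. \<exists>v. admissible v r \<and> f = alpha v r})"

definition p1 :: "params \<Rightarrow> complex \<Rightarrow> complex" where
  "p1 v r = ((b2 v)^2 + 8 * b2 v * (b0 v + b1 v) - 4 * (b1 v)^2) * r^2
     + 4 * b2 v * (2 * s2 v + b1 v - 2 * b2 v) * r - 2 * (b2 v)^2"

definition p2 :: "params \<Rightarrow> complex \<Rightarrow> complex" where
  "p2 v r = (4 * b0 v + 2 * b1 v - b2 v) * r^3 + (8 * s1 v + 4 * s2 v + 4 * b0 v - b2 v) * r^2
     + (b2 v - 4 * s2 v - 2 * b1 v) * r + b2 v"

definition p3 :: "params \<Rightarrow> complex \<Rightarrow> complex" where
  "p3 v r = (2 * b1 v - 4 * b0 v - 3 * b2 v) * r^3 + (8 * s1 v - 4 * s2 v + 4 * b0 v - b2 v) * r^2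
     + (3 * b2 v - 4 * s2 v - 2 * b1 v) * r + b2 v"

definition p4 :: "params \<Rightarrow> complex \<Rightarrow> complex" where
  "p4 v r = (8 * s1 v + 4 * b0 v) * r^2 + (2 * b2 v - 4 * s2 v - 2 * b1 v) * r + b2 v"

definition dcoeff :: "params \<Rightarrow> complex \<Rightarrow> nat \<Rightarrow> complex" where
  "dcoeff v r k =
     [(b2 v)^2, p1 v r, (p4 v r)^2 - p2 v r * p3 v r, p2 v r * p3 v r, (p4 v r)^2] ! k"

definition yfun :: "complex \<Rightarrow> nat \<Rightarrow> ratfun" where
  "yfun r k =
     [(cst (4 * r^2) * \<nn>)^2 * (\<nn> * cst r - cst (2 * r) + 1)^2,
      cst (4 * r^3) * \<nn> * (\<nn> * cst r - cst (2 * r) + 1),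
      1,
      cst ((r - 1) * (3 * r - 1)) /
        ((2 * \<nn> * cst r - cst r + 1) * (2 * \<nn> * cst r - cst (3 * r) + 1)),
      cst (- ((2 * r - 1)^2)) / (2 * \<nn> * cst r - cst (2 * r) + 1)^2] ! k"

lemma cst_0: "cst 0 = 0" and cst_1: "cst 1 = 1"
  by (simp_all add: cst_def Zero_fract_def One_fract_def one_pCons)

lemma cst_add: "cst (a + b) = cst a + cst b"
  and cst_diff: "cst (a - b) = cst a - cst b"
  and cst_mult: "cst (a * b) = cst a * cst b"
  and cst_uminus: "cst (- a) = - cst a"
  by (simp_all add: cst_def mult.commute)

lemma cst_power: "cst (a ^ n) = cst a ^ n"
  by (induction n) (simp_all add: cst_1 cst_mult)

lemma cst_of_nat: "cst (of_nat n) = of_nat n"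
  by (induction n) (simp_all add: cst_0 cst_1 cst_add)

lemma cst_numeral: "cst (numeral w) = numeral w"
  using cst_of_nat[of "numeral w"] by simp

lemma cst_eq_0_iff: "cst a = 0 \<longleftrightarrow> a = 0"
  by (simp add: cst_def Zero_fract_def eq_fract)

lemma ratfun_numeral_neq_0: "(numeral w :: ratfun) \<noteq> 0"
  using cst_eq_0_iff[of "numeral w"] by (simp add: cst_numeral)

lemma cst_divide: "cst (a / b) = cst a / cst b"
proof (cases "b = 0")
  case False
  have "cst (a / b) * cst b = cst a"
    using False by (simp flip: cst_mult)
  then show ?thesis
    using False by (simp add: cst_eq_0_iff eq_divide_eq)
qed (simp add: cst_0)

lemmas cst_simps =
  cst_0 cst_1 cst_add cst_diff cst_mult cst_uminus cst_power cst_numeral cst_divide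

lemma linear_ratfun_nonzero:
  assumes "r \<noteq> 0"
  shows "2 * \<nn> * cst r + cst c \<noteq> 0"
proof -
  have "2 * \<nn> * cst r + cst c = Fract [:c, 2 * r:] 1"
    using cst_numeral[of "num.Bit0 num.One"]
    by (simp add: cst_def var_n_def mult.commute flip: cst_numeral)
  then show ?thesis
    using assms by (simp add: Zero_fract_def eq_fract)
qed

lemma partial_fractions_field:
  fixes q1 q2 q3 q4 n r b0 b1 b2 s1 s2 :: "'a::field"
  assumes D: "D0 = 2*n*r-r+1" "D1 = 2*n*r-2*r+1" "D2=2*n*r-3*r+1"
  assumes x: "x0 = b0 + b1 * n + b2 * n * (n - 1)" "x1 = b0 + b1 * (n-1) + b2 * (n-1) * (n - 1 - 1)"
    "x2 = b0 + b1 * (n-2) + b2 * (n-2) * (n - 2 - 1)"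
  assumes G0: "G0 = (n+1)*((n*r+1)*x0 + n*s2+s1)"
  assumes G1: "G1 = n*((n*r-r+1)*x1 + (n-1)*s2+s1)"
  assumes G2: "G2 = (n-1)*((n*r-2*r+1)*x2 + (n-2)*s2+s1)"
  assumes q1: "q1 = ((b2)^2 + 8 * b2 * (b0 + b1) - 4 * (b1)^2) * r^2
     + 4 * b2 * (2 * s2 + b1 - 2 * b2) * r - 2 * (b2)^2"
 and q2: "q2 = (4 * b0 + 2 * b1 - b2) * r^3 + (8 * s1 + 4 * s2 + 4 * b0 - b2) * r^2
     + (b2 - 4 * s2 - 2 * b1) * r + b2"
 and q3: "q3 = (2 * b1 - 4 * b0 - 3 * b2) * r^3 + (8 * s1 - 4 * s2 + 4 * b0 - b2) * r^2
     + (3 * b2 - 4 * s2 - 2 * b1) * r + b2"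
 and q4: "q4 = (8 * s1 + 4 * b0) * r^2 + (2 * b2 - 4 * s2 - 2 * b1) * r + b2"
  shows "128 * r^6 * G1 * (G0*D1*D2 - 2*G1*D0*D2 + G2*D0*D1 - 2*D0*D1*D2*(x0 - x1))
    = (b2^2 * ((4*r^2*n)^2*(n*r-2*r+1)^2) + q1 * (4*r^3*n*(n*r-2*r+1)) + (q4^2-q2*q3)) * D0*D1^2*D2
      + q2*q3*(r-1)*(3*r-1)*D1^2 - q4^2*(2*r-1)^2*D0*D2"
  unfolding assms
  by algebra

lemma partial_fractions:
  assumes r: "r \<noteq> 0"
  shows "alpha v r = cst (1 / (256 * r^6)) * (\<Sum>k\<le>4. cst (dcoeff v r k) * yfun r k)"
proof -
  let ?R = "cst r"
  define D0 D1 D2 where D: "D0 = 2 * \<nn> * ?R - ?R + 1" "D1 = 2 * \<nn> * ?R - 2 * ?R + 1"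
    "D2 = 2 * \<nn> * ?R - 3 * ?R + 1"
  note ratfun_numeral_neq_0[simp]
  have nz: "D0 \<noteq> 0" "D1 \<noteq> 0" "D2 \<noteq> 0" "?R \<noteq> 0"
    using linear_ratfun_nonzero[OF r, of "1 - r"] linear_ratfun_nonzero[OF r, of "1 - 2 * r"]
      linear_ratfun_nonzero[OF r, of "1 - 3 * r"] r
    by (simp_all add: D cst_simps algebra_simps cst_eq_0_iff)
  define x0 x1 x2 where x: "x0 = xseq v \<nn>" "x1 = xseq v (\<nn> - 1)" "x2 = xseq v (\<nn> - 2)"
  define G0 where G0: "G0 = (\<nn> + 1) * ((\<nn> * ?R + 1) * x0 + \<nn> * cst (s2 v) + cst (s1 v))"
  define G1 where G1: "G1 = \<nn> * ((\<nn> * ?R - ?R + 1) * x1 + (\<nn> - 1) * cst (s2 v) + cst (s1 v))"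
  define G2 where G2: "G2 = (\<nn> - 1) * ((\<nn> * ?R - 2 * ?R + 1) * x2 + (\<nn> - 2) * cst (s2 v) + cst (s1 v))"
  define q1 q2 q3 q4 where q: "q1 = cst (p1 v r)" "q2 = cst (p2 v r)" "q3 = cst (p3 v r)" "q4 = cst (p4 v r)"
  define Y where "Y = (cst (b2 v))^2 * ((4 * ?R^2 * \<nn>)^2 * (\<nn> * ?R - 2 * ?R + 1)^2)
    + q1 * (4 * ?R^3 * \<nn> * (\<nn> * ?R - 2 * ?R + 1)) + (q4^2 - q2 * q3)"
  have key: "128 * ?R^6 * G1 * (G0*D1*D2 - 2*G1*D0*D2 + G2*D0*D1 - 2*D0*D1*D2*(x0 - x1))
    = Y * D0*D1^2*D2 + q2*q3*(?R-1)*(3*?R-1)*D1^2 - q4^2*(2*?R-1)^2*D0*D2"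
    unfolding Y_def
    by (rule partial_fractions_field[where ?b0.0 = "cst (b0 v)" and ?b1.0 = "cst (b1 v)" and
          ?b2.0 = "cst (b2 v)" and ?s1.0 = "cst (s1 v)" and ?s2.0 = "cst (s2 v)" and
          n = \<nn> and r = ?R and ?x2.0 = x2])
       (simp_all only: D x G0 G1 G2 xseq_def q p1_def p2_def p3_def p4_def cst_simps)
  have g: "gam v \<nn> 0 r = G0 / D0" "gam v \<nn> 1 r = G1 / D1" "gam v \<nn> 2 r = G2 / D2"
    by (simp_all add: gam_def G0 G1 G2 D x algebra_simps)
  have lhs: "alpha v r = G1 / D1 * (1/2 * (G0 / D0 - 2 * (G1 / D1) + G2 / D2) - (x0 - x1))"
    by (simp add: alpha_def g x)
  have y: "yfun r 3 = (?R - 1) * (3 * ?R - 1) / (D0 * D2)" "yfun r 4 = - ((2 * ?R - 1)^2) / D1^2"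
    by (simp_all add: yfun_def D cst_simps)
  have "{..4::nat} = {0,1,2,3,4}"
    by auto
  then have "(\<Sum>k\<le>4. cst (dcoeff v r k) * yfun r k)
      = Y + q2 * q3 * (yfun r 3) + q4^2 * yfun r 4"
    by (simp add: dcoeff_def yfun_def Y_def cst_simps q)
  also have "\<dots> = 256 * ?R^6 * alpha v r"
  proof -
    have "(Y + q2 * q3 * (yfun r 3) + q4^2 * yfun r 4) * (D0 * D1^2 * D2)
        = Y * D0*D1^2*D2 + q2*q3*(?R-1)*(3*?R-1)*D1^2 - q4^2*(2*?R-1)^2*D0*D2"
      using nz by (simp add: y field_simps)
    also have "\<dots> = 256 * ?R^6 * alpha v r * (D0 * D1^2 * D2)"
      unfolding key[symmetric] lhs using nz by (simp add: field_simps power2_eq_square)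
    finally show ?thesis
      using nz by simp
  qed
  finally show ?thesis
    using nz by (simp add: cst_simps)
qed

text \<open>
  For \<open>r \<in> {1, 1/3}\<close> the term \<open>yfun r 3\<close> vanishes, for \<open>r = 1/2\<close> the term \<open>yfun r 4\<close> does; the other
  \<open>yfun r k\<close> are linearly independent. So for \<open>k \<in> \<I> r\<close> the value \<open>dcoeff v r k\<close> depends on \<open>v\<close> only
  through \<open>alpha v r\<close>, and the choice of \<open>v\<close> in \<open>subclassC\<close> is immaterial.
\<close>

definition index_set :: "complex \<Rightarrow> nat set"  (\<open>\<I>\<close>) where
  "\<I> r = (if r = 1/2 then {0, 1, 2, 3} else {0, 1, 2, 4})"

definition has_pattern :: "params \<Rightarrow> complex \<Rightarrow> nat set \<Rightarrow> bool" where
  "has_pattern v r A \<longleftrightarrow> (\<forall>k\<in>\<I> r. dcoeff v r k \<noteq> 0 \<longleftrightarrow> k \<in> A)"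

definition subclassC :: "complex \<Rightarrow> nat set \<Rightarrow> ratfun set" where
  "subclassC r A = {f \<in> \<C> r. \<exists>v. admissible v r \<and> f = alpha v r \<and> has_pattern v r A}"

end

theory Submission
  imports Defs
begin

text \<open>
  For the three special values of \<open>r\<close> everything is a function of \<open>u = n (n + 1/r - 2)\<close>: the denominator of
  the one surviving fraction is a constant multiple of \<open>4u + \<epsilon>\<close> with \<open>\<epsilon> = \<plusminus>1\<close>, and
  \<open>\<alpha>(n,r) = (b\<^sub>2\<^sup>2/16) u\<^sup>2 + (d\<^sub>1/(64r\<^sup>2)) u + (d\<^sub>2 - d\<^sub>k/(4u + \<epsilon>))/(256r\<^sup>6)\<close>,
  where \<open>k = 3\<close> for \<open>r = 1/2\<close> and \<open>k = 4\<close> otherwise. Since \<open>u\<close> is transcendental over the constants, the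
  \<open>d\<close>'s can be read off from \<open>\<alpha>\<close>. A member of \<open>\<C> 0\<close> is a polynomial vanishing at \<open>n = 0\<close>, where
  \<open>u = 0\<close>: having no pole at a root of \<open>4u + \<epsilon>\<close> forces \<open>d\<^sub>k = 0\<close>, and the value at \<open>0\<close> then forces
  \<open>d\<^sub>2 = 0\<close>. Conversely \<open>u (e\<^sup>2 u + d)\<close> always has the shape that defines \<open>\<C> 0\<close>. For \<open>r = 1\<close>,
  admissibility says precisely \<open>d\<^sub>3 = d\<^sub>4 - d\<^sub>2 \<noteq> 0\<close>. Nonemptiness is shown by explicit parameters.
\<close>


section \<open>The substitution u = n(n + 1/r - 2) and the constants that go with it\<close>

definition last_index :: "complex \<Rightarrow> nat" where
  "last_index r = (if r = 1/2 then 3 else 4)"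

text \<open>Chosen so that 4u + \<open>pole_shift r\<close> is (2n-1)^2, (2n-1)(2n+1), (2n+1)^2 for
  r = 1, 1/2, 1/3.\<close>

definition pole_shift :: "complex \<Rightarrow> complex" where
  "pole_shift r = (if r = 1/2 then -1 else 1)"

definition quad :: "complex \<Rightarrow> complex poly" where
  "quad r = [:0, 1 / r - 2, 1:]"

text \<open>
  With \<open>u = quad r\<close>, this is the cubic in \<open>u\<close> that is the numerator of \<open>alpha v r\<close> over \<open>4u + pole_shift r\<close>.
\<close>

definition cubic :: "params \<Rightarrow> complex \<Rightarrow> complex poly" where
  "cubic v r = [:dcoeff v r 2 / (256 * r^6), dcoeff v r 1 / (64 * r^2), (b2 v / 4)^2:] * [:pole_shift r, 4:]
     - [:dcoeff v r (last_index r) / (256 * r^6):]"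

lemma var_n_eq_to_fract: "\<nn> = to_fract [:0, 1:]"
  by (simp add: var_n_def to_fract_def)

lemma cst_eq_to_fract: "cst c = to_fract [:c:]"
  by (simp add: cst_def to_fract_def)

lemma dcoeff_simps:
  "dcoeff v r 0 = (b2 v)^2" "dcoeff v r (Suc 0) = p1 v r" "dcoeff v r 1 = p1 v r"
  "dcoeff v r 2 = (p4 v r)^2 - p2 v r * p3 v r" "dcoeff v r 3 = p2 v r * p3 v r"
  "dcoeff v r 4 = (p4 v r)^2"
  by (simp_all add: dcoeff_def)

text \<open>Horner's rule, for unfolding embedded coefficient lists.\<close>

lemma to_fract_pCons: "to_fract (pCons c p) = cst c + \<nn> * to_fract p"
proof -
  have "pCons c p = [:c:] + [:0, 1:] * p" by simp
  then show ?thesis by (simp add: var_n_eq_to_fract cst_eq_to_fract del: mult_pCons_left)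
qed

lemma to_fract_pcompose_pCons:
  "to_fract (pcompose (pCons c p) q) = cst c + to_fract q * to_fract (pcompose p q)"
  by (simp add: pcompose_pCons cst_eq_to_fract)

section \<open>Alpha as a function of u\<close>

text \<open>Since n(nr - 2r + 1) = ru, the functions y_0, y_1, y_2 are 16 r^6 u^2, 4 r^4 u and
  1.\<close>

lemma alpha_expansion:
  assumes "r \<in> {1, 1/2, 1/3}"
  defines "u \<equiv> to_fract (quad r)"
  shows "alpha v r = cst ((b2 v / 4)^2) * u^2 + cst (dcoeff v r 1 / (64 * r^2)) * u
    + cst (dcoeff v r 2 / (256 * r^6)) - cst (dcoeff v r (last_index r) / (256 * r^6)) / (4 * u + cst (pole_shift r))"
proof -
  note ratfun_numeral_neq_0[simp]
  have r: "r \<noteq> 0" "cst r \<noteq> 0" using assms by (auto simp: cst_eq_0_iff)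
  have u: "u = \<nn> * (\<nn> + cst (1 / r - 2))"
    by (simp add: u_def quad_def to_fract_pCons cst_0 cst_1 add.commute)
  have ru: "\<nn> * (\<nn> * cst r - cst (2 * r) + 1) = cst r * u"
    using r by (simp add: u cst_simps field_simps)
  have "yfun r 0 = (4 * cst r^2)^2 * (\<nn> * (\<nn> * cst r - cst (2 * r) + 1))^2"
    by (simp add: yfun_def cst_simps power_mult_distrib)
  then have y0: "yfun r 0 = 16 * cst r^6 * u^2"
    unfolding ru by algebra
  have "yfun r 1 = 4 * cst r^3 * (\<nn> * (\<nn> * cst r - cst (2 * r) + 1))"
    by (simp add: yfun_def cst_simps)
  then have y1: "yfun r 1 = 4 * cst r^4 * u"
    unfolding ru by algebra
  have y2: "yfun r 2 = 1"
    by (simp add: yfun_def)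
  consider "r = 1" | "r = 1/2" | "r = 1/3" using assms by auto
  \<comment> \<open>One of y_3, y_4 has numerator zero; the other equals -1/(4u +
    \<open>pole_shift r\<close>) exactly.\<close>
  then have tail: "cst (dcoeff v r 3) * yfun r 3 + cst (dcoeff v r 4) * yfun r 4
      = - cst (dcoeff v r (last_index r)) / (4 * u + cst (pole_shift r))"
  proof cases
    case 1
    have "4 * u + cst (pole_shift r) = (2 * \<nn> - 1)^2"
      by (simp add: u 1 pole_shift_def cst_simps power2_eq_square algebra_simps)
    then show ?thesis
      by (simp add: 1 last_index_def yfun_def cst_simps)
  next
    case 2
    have "4 * u + cst (pole_shift r) = 4 * ((2 * \<nn> * cst r - cst r + 1) * (2 * \<nn> * cst r - cst (3 * r) + 1))"
      unfolding 2 by (simp add: u 2 pole_shift_def cst_simps field_simps)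
    then show ?thesis
      unfolding 2 by (simp add: last_index_def yfun_def cst_simps)
  next
    case 3
    have "4 * u + cst (pole_shift r) = 9 * (2 * \<nn> * cst r - cst (2 * r) + 1)^2"
      unfolding 3 by (simp add: u 3 pole_shift_def cst_simps power2_eq_square field_simps)
    then show ?thesis
      unfolding 3 by (simp add: last_index_def yfun_def cst_simps power2_eq_square)
  qed
  have "{..4::nat} = {0,1,2,3,4}" by auto
  then have "(\<Sum>k\<le>4. cst (dcoeff v r k) * yfun r k) =
      cst ((b2 v)^2) * yfun r 0 + cst (dcoeff v r 1) * yfun r 1 + cst (dcoeff v r 2) * yfun r 2
       + (cst (dcoeff v r 3) * yfun r 3 + cst (dcoeff v r 4) * yfun r 4)"
    by (simp add: dcoeff_def add.assoc)
  then have "alpha v r = cst (1 / (256 * r^6)) * (cst ((b2 v)^2) * (16 * cst r^6 * u^2)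
      + cst (dcoeff v r 1) * (4 * cst r^4 * u) + cst (dcoeff v r 2)
      - cst (dcoeff v r (last_index r)) / (4 * u + cst (pole_shift r)))"
    unfolding partial_fractions[OF r(1)] y0 y1 y2 tail by simp
  moreover have "cst (1 / (256 * r^6)) * (cst ((b2 v)^2) * (16 * cst r^6 * u^2)) = cst ((b2 v / 4)^2) * u^2"
    "cst (1 / (256 * r^6)) * (cst (dcoeff v r 1) * (4 * cst r^4 * u)) = cst (dcoeff v r 1 / (64 * r^2)) * u"
    using r by (simp_all add: cst_simps field_simps flip: power_add)
  ultimately show ?thesis
    by (simp add: distrib_left right_diff_distrib cst_divide cst_1)
qed

lemma degree_quad: "degree (quad r) = 2"
  by (simp add: quad_def)

text \<open>Supplies a zero of 4u + \<open>pole_shift r\<close>, the place where a pole of alpha can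
  be detected.\<close>

lemma quad_root:
  assumes "r \<in> {1, 1/2, 1/3}"
  shows "\<exists>a. poly (quad r) a = - pole_shift r / 4"
proof -
  consider "r = 1" | "r = 1/2" | "r = 1/3" using assms by auto
  then show ?thesis
  proof cases
    case 1
    show ?thesis unfolding 1 by (rule exI[of _ "1/2"]) (simp add: quad_def pole_shift_def)
  next
    case 2
    show ?thesis unfolding 2 by (rule exI[of _ "1/2"]) (simp add: quad_def pole_shift_def)
  next
    case 3
    show ?thesis unfolding 3 by (rule exI[of _ "- 1/2"]) (simp add: quad_def pole_shift_def)
  qed
qed

text \<open>Transcendence of u over the constants: composition with a nonconstant polynomial is
  injective.\<close>

lemma pcompose_quad_eq_0: "pcompose p (quad r) = 0 \<Longrightarrow> p = 0"
  by (rule pcompose_eq_0[of _ "quad r"]) (auto simp: degree_quad)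

lemma pole_factor_nonzero: "pcompose [:e, 4:] (quad r) \<noteq> 0"
  using pcompose_quad_eq_0 by fastforce

text \<open>Clearing the denominator turns questions about rational functions into polynomial
  identities.\<close>

lemma alpha_reduced:
  assumes "r \<in> {1, 1/2, 1/3}"
  shows "alpha v r * to_fract (pcompose [:pole_shift r, 4:] (quad r)) = to_fract (pcompose (cubic v r) (quad r))"
proof -
  let ?u = "to_fract (quad r)"
  have pole: "to_fract (pcompose [:pole_shift r, 4:] (quad r)) = 4 * ?u + cst (pole_shift r)"
    by (simp add: to_fract_pcompose_pCons cst_simps flip: cst_eq_to_fract)
  then have nz: "4 * ?u + cst (pole_shift r) \<noteq> 0"
    using pole_factor_nonzero[of "pole_shift r" r] by (metis to_fract_eq_0_iff)
  have cancel: "(a - b / D) * D = a * D - b" if "D \<noteq> 0" for a b D :: ratfun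
    using that by (simp add: left_diff_distrib)
  show ?thesis
    unfolding pole alpha_expansion[OF assms] cancel[OF nz] cubic_def pcompose_diff pcompose_mult
      to_fract_diff to_fract_mult
    by (simp add: to_fract_pcompose_pCons flip: cst_eq_to_fract)
       (simp add: algebra_simps power2_eq_square cst_numeral)
qed

section \<open>Recovering the coefficients from alpha\<close>

text \<open>Uniqueness of quotient and remainder on division by a linear polynomial; 4 is nonzero in
  characteristic 0.\<close>

lemma mult_diff_const_poly_unique:
  fixes a0 :: "'a::{field_char_0}"
  assumes "[:a0, a1, a2:] * [:e, 4:] - [:c:] = [:a0', a1', a2':] * [:e, 4:] - [:c':]"
  shows "a0 = a0'" "a1 = a1'" "a2 = a2'" "c = c'"
  using assms by auto

text \<open>Plays the part of linear independence of the surviving y_k: patterns belong to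
  functions, not to parameter vectors.\<close>

lemma alpha_eq_imp_dcoeff_eq:
  assumes r: "r \<in> {1, 1/2, 1/3}" and eq: "alpha v r = alpha w r" and k: "k \<in> \<I> r"
  shows "dcoeff v r k = dcoeff w r k"
proof -
  have "pcompose (cubic v r) (quad r) = pcompose (cubic w r) (quad r)"
    using alpha_reduced[OF r, of v] alpha_reduced[OF r, of w] eq by (metis to_fract_eq_iff)
  then have "pcompose (cubic v r - cubic w r) (quad r) = 0"
    by (simp add: pcompose_diff)
  then have "cubic v r = cubic w r"
    using pcompose_quad_eq_0 by fastforce
  note coeffs = mult_diff_const_poly_unique[OF this[unfolded cubic_def]]
  have "r \<noteq> 0"
    using r by auto
  \<comment> \<open>The leading coefficient yields only the square of \<open>b2\<close>, which is
    all that d_0 records.\<close>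
  then have *: "dcoeff v r 0 = dcoeff w r 0" "dcoeff v r 1 = dcoeff w r 1" "dcoeff v r 2 = dcoeff w r 2"
    "dcoeff v r (last_index r) = dcoeff w r (last_index r)"
    using coeffs by (simp_all add: dcoeff_simps(1) power_divide)
  have "k \<in> {0, 1, 2, last_index r}"
    using k by (auto simp: index_set_def last_index_def split: if_splits)
  then show ?thesis
    using * by auto
qed

lemma subclassC_disjoint:
  assumes "r \<in> {1, 1/2, 1/3}" "A \<subseteq> \<I> r" "B \<subseteq> \<I> r" "A \<noteq> B"
  shows "subclassC r A \<inter> subclassC r B = {}"
proof -
  have "A = B" if "f \<in> subclassC r A" "f \<in> subclassC r B" for f
  proof -
    obtain v where v: "f = alpha v r" "has_pattern v r A"
      using \<open>f \<in> subclassC r A\<close> unfolding subclassC_def by blast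
    obtain w where w: "f = alpha w r" "has_pattern w r B"
      using \<open>f \<in> subclassC r B\<close> unfolding subclassC_def by blast
    have "k \<in> A \<longleftrightarrow> k \<in> B" if "k \<in> \<I> r" for k
      using that v w alpha_eq_imp_dcoeff_eq[OF assms(1)] unfolding has_pattern_def by metis
    then show ?thesis
      using assms(2,3) by blast
  qed
  then show ?thesis
    using assms(4) by blast
qed

section \<open>Comparison with C_0\<close>

text \<open>Without d_2 and the remainder, \<open>cubic\<close> is divisible by 4u +
  \<open>pole_shift r\<close>, and this factor cancels.\<close>

lemma alpha_polynomial:
  assumes r: "r \<in> {1, 1/2, 1/3}" and "dcoeff v r 2 = 0" "dcoeff v r (last_index r) = 0"
  shows "alpha v r = to_fract (pcompose [:0, dcoeff v r 1 / (64 * r^2), (b2 v / 4)^2:] (quad r))"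
proof -
  have "cubic v r = [:0, dcoeff v r 1 / (64 * r^2), (b2 v / 4)^2:] * [:pole_shift r, 4:]"
    by (simp add: cubic_def assms)
  then have "alpha v r * to_fract (pcompose [:pole_shift r, 4:] (quad r)) =
     to_fract (pcompose [:0, dcoeff v r 1 / (64 * r^2), (b2 v / 4)^2:] (quad r)) * to_fract (pcompose [:pole_shift r, 4:] (quad r))"
    using alpha_reduced[OF r, of v] by (simp only: pcompose_mult to_fract_mult)
  then show ?thesis
    using pole_factor_nonzero by simp
qed

text \<open>The factored form keeps the zero at n = 0 visible.\<close>

lemma alpha_zero_eq:
  "alpha_zero w = to_fract ([:0, 1:] * [:s2 w - b2 w, b2 w:] *
     [:2 * b2 w - b1 w - s2 w + b0 w + s1 w, b1 w + s2 w - 3 * b2 w, b2 w:])"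
  by (simp only: to_fract_mult to_fract_pCons to_fract_0 alpha_zero_def cst_simps)
     (simp add: power2_eq_square algebra_simps)

text \<open>The target is u(e^2 u + d). The square matches the coefficient
  \<open>(b2 v / 4)^2\<close>, so no root has to be extracted.\<close>

lemma alpha_zero_represents_quadratic:
  obtains w where "alpha_zero w = to_fract (pcompose [:0, d, e^2:] (quad r))"
proof (cases "e = 0")
  case True
  \<comment> \<open>The last two factors of \<open>alpha_zero\<close> become 1 and d(n + 1/r -
    2).\<close>
  have "alpha_zero (Params (d * (1 / r - 1)) (d - 1) 0 0 1) = to_fract (pcompose [:0, d, e^2:] (quad r))"
    unfolding alpha_zero_eq using True by (simp add: quad_def pcompose_pCons algebra_simps)
  then show ?thesis ..
next
  case False
  define c where "c = 1 / r - 2"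
  \<comment> \<open>The last two factors become e(n + c) and eu + d/e, hence the case split on
    e.\<close>
  have "alpha_zero (Params (e * (1 + c) + d / e) (2 * e) e 0 (e * (1 + c))) = to_fract (pcompose [:0, d, e^2:] (quad r))"
    unfolding alpha_zero_eq using False
    by (simp add: quad_def pcompose_pCons c_def[symmetric] algebra_simps power2_eq_square)
  then show ?thesis ..
qed

lemma subclassC_subset_C0:
  assumes r: "r \<in> {1, 1/2, 1/3}" and A: "A \<in> {{0}, {1}, {0,1}}"
  shows "subclassC r A \<subseteq> \<C> 0"
proof
  fix f assume "f \<in> subclassC r A"
  then obtain v where v: "f = alpha v r" "has_pattern v r A"
    unfolding subclassC_def by auto
  have "dcoeff v r 2 = 0" "dcoeff v r (last_index r) = 0" and nz: "dcoeff v r 0 \<noteq> 0 \<or> dcoeff v r 1 \<noteq> 0"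
    using v(2) A by (auto simp: has_pattern_def index_set_def last_index_def split: if_splits)
  then have f: "f = to_fract (pcompose [:0, dcoeff v r 1 / (64 * r^2), (b2 v / 4)^2:] (quad r))"
    using v(1) alpha_polynomial[OF r] by simp
  \<comment> \<open>C_0 excludes the zero function; here d_0 or d_1 is nonzero.\<close>
  have "[:0, dcoeff v r 1 / (64 * r^2), (b2 v / 4)^2:] \<noteq> 0"
    using nz r by (auto simp: dcoeff_simps)
  then have "f \<noteq> 0"
    unfolding f to_fract_eq_0_iff using pcompose_quad_eq_0 by blast
  moreover obtain w where "f = alpha_zero w"
    using alpha_zero_represents_quadratic[of "dcoeff v r 1 / (64 * r^2)" "b2 v / 4" r] unfolding f by metis
  ultimately show "f \<in> \<C> 0"
    by (auto simp: classC_def)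
qed

lemma alpha_in_C0_imp:
  assumes r: "r \<in> {1, 1/2, 1/3}" and "alpha v r \<in> \<C> 0"
  shows "dcoeff v r 2 = 0" "dcoeff v r (last_index r) = 0"
proof -
  obtain w where "alpha v r = alpha_zero w"
    using assms(2) by (auto simp: classC_def)
  then obtain R where "alpha v r = to_fract ([:0, 1:] * R)"
    unfolding alpha_zero_eq mult.assoc by blast
  then have "[:0, 1:] * R * pcompose [:pole_shift r, 4:] (quad r) = pcompose (cubic v r) (quad r)"
    using alpha_reduced[OF r, of v] by (metis to_fract_eq_iff to_fract_mult)
  then have *: "poly ([:0, 1:] * R * pcompose [:pole_shift r, 4:] (quad r)) x = poly (cubic v r) (poly (quad r) x)" for x
    by (simp add: poly_pcompose)
  obtain a where a: "poly (quad r) a = - pole_shift r / 4"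
    using quad_root[OF r] by blast
  \<comment> \<open>The left side of * vanishes at a zero of 4u + \<open>pole_shift r\<close>, while
    \<open>cubic\<close> is reduced there to its remainder, a multiple of the last
    coefficient.\<close>
  have "poly (cubic v r) (- pole_shift r / 4) = 0"
    using *[of a] by (simp add: a poly_pcompose)
  then show last: "dcoeff v r (last_index r) = 0"
    using r by (auto simp: cubic_def)
  \<comment> \<open>At n = 0 also u = 0, leaving the constant term of \<open>cubic\<close>, now a
    nonzero multiple of d_2.\<close>
  have "poly (cubic v r) 0 = 0"
    using *[of 0] by (simp add: quad_def)
  then show "dcoeff v r 2 = 0"
    using r last by (auto simp: cubic_def pole_shift_def split: if_splits)
qed

section \<open>The excluded patterns for r = 1\<close>

text \<open>Here alpha is a polynomial multiple of u = n(n - 1), which vanishes at n = 1.\<close>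

lemma alpha_vanishes_at_1:
  assumes "has_pattern v 1 A" "A \<in> {{0}, {1}, {0,1}}"
  shows "has_value_at (alpha v 1) 1 0"
proof -
  have "dcoeff v 1 2 = 0" "dcoeff v 1 (last_index 1) = 0"
    using assms by (auto simp: has_pattern_def index_set_def last_index_def)
  then have "alpha v 1 = to_fract (pcompose [:0, dcoeff v 1 1 / (64 * 1^2), (b2 v / 4)^2:] (quad 1))"
    by (intro alpha_polynomial) auto
  then show ?thesis
    unfolding has_value_at_def to_fract_def
    by (intro exI[of _ "pcompose [:0, dcoeff v 1 1 / (64 * 1^2), (b2 v / 4)^2:] (quad 1)"] exI[of _ 1])
       (simp add: poly_pcompose quad_def)
qed

lemma subclassC_1_imp:
  assumes "subclassC 1 A \<noteq> {}"
  shows "2 \<in> A \<or> 4 \<in> A"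
proof -
  obtain v where v: "admissible v 1" "has_pattern v 1 A"
    using assms by (auto simp: subclassC_def)
  \<comment> \<open>At r = 1 the factors are 8(s_1 + b_0) and 8(s_1 - s_2). As d_2 = d_4 - d_3, a
    nonzero d_3 keeps d_2 and d_4 from vanishing together.\<close>
  have "p2 v 1 * p3 v 1 = - 64 * ((s1 v + b0 v) * (s2 v - 1 * s1 v))"
    by (simp add: p2_def p3_def algebra_simps)
  then have "p2 v 1 * p3 v 1 \<noteq> 0"
    using v(1) by (simp add: admissible_def)
  then show ?thesis
    using v(2) by (auto simp: has_pattern_def index_set_def dcoeff_simps)
qed

lemma subclassC_nonempty:
  assumes "r \<noteq> 0" "admissible v r" "has_pattern v r A"
  shows "subclassC r A \<noteq> {}"
  using assms by (auto simp: subclassC_def classC_def)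

section \<open>Enumeration of the subsets of the index sets\<close>

lemma subsets_of_index_set:
  assumes "k \<notin> {0, 1, 2::nat}"
  shows "{A. A \<subseteq> {0, 1, 2, k} \<and> (2 \<in> A \<or> k \<in> A)} =
    {{0,1,2,k}, {1,2,k}, {0,2,k}, {0,1,k}, {0,1,2}, {2,k}, {1,k}, {0,k}, {1,2}, {0,2}, {2}, {k}}"
  (is "?L = ?R")
proof
  show "?R \<subseteq> ?L" using assms by auto
  show "?L \<subseteq> ?R"
  proof
    fix A assume "A \<in> ?L"
    then have A: "A \<subseteq> {0, 1, 2, k}" "2 \<in> A \<or> k \<in> A"
      by simp_all
    \<comment> \<open>Rebuilding A from its four membership bits makes every case a literal
      set.\<close>
    have eq: "A = (if 0 \<in> A then insert 0 else id) ((if 1 \<in> A then insert 1 else id)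
       ((if 2 \<in> A then insert 2 else id) (if k \<in> A then {k} else {})))"
      using A(1) by auto
    have "\<dots> \<in> ?R"
      using A(2)
      by (cases "0 \<in> A"; cases "1 \<in> A"; cases "2 \<in> A"; cases "k \<in> A") simp_all
    then show "A \<in> ?R"
      unfolding eq[symmetric] .
  qed
qed

lemma subsets_01:
  assumes "A \<subseteq> {0, 1::nat}" "A \<noteq> {}"
  shows "A \<in> {{0}, {1}, {0, 1}}"
proof -
  have "A \<in> Pow {0, 1}"
    using assms(1) by simp
  then show ?thesis
    using assms(2) unfolding Pow_insert Pow_empty by auto
qed

lemma nonempty_subset_cases:
  assumes "k \<notin> {0, 1, 2::nat}" "A \<subseteq> {0, 1, 2, k}" "A \<noteq> {}"
  shows "A \<in> {{0,1,2,k}, {1,2,k}, {0,2,k}, {0,1,k}, {0,1,2}, {2,k}, {1,k}, {0,k}, {1,2}, {0,2}, {2}, {k}}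
    \<or> A \<in> {{0}, {1}, {0,1}}"
proof (cases "2 \<in> A \<or> k \<in> A")
  case True
  then have "A \<in> {A. A \<subseteq> {0, 1, 2, k} \<and> (2 \<in> A \<or> k \<in> A)}"
    using assms(2) by simp
  then show ?thesis
    unfolding subsets_of_index_set[OF assms(1)] by (rule disjI1)
next
  case False
  then have "A \<subseteq> {0, 1}"
    using assms(2) by auto
  then show ?thesis
    using assms(3) by (intro disjI2 subsets_01)
qed

text \<open>For the converse a single member suffices, as its pattern already rules out C_0;
  nonemptiness provides it.\<close>

lemma subclassC_not_subset_C0_iff:
  assumes r: "r \<in> {1, 1/2, 1/3}" and A: "A \<subseteq> \<I> r" "A \<noteq> {}" and "subclassC r A \<noteq> {}"
  shows "\<not> subclassC r A \<subseteq> \<C> 0 \<longleftrightarrow> 2 \<in> A \<or> last_index r \<in> A"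
proof
  assume "\<not> subclassC r A \<subseteq> \<C> 0"
  then have "A \<notin> {{0}, {1}, {0,1}}"
    using subclassC_subset_C0[OF r] by blast
  moreover have "A \<in> {{0}, {1}, {0,1}}" if "2 \<notin> A" "last_index r \<notin> A"
  proof (rule subsets_01)
    show "A \<subseteq> {0, 1}"
      using A(1) that by (auto simp: index_set_def last_index_def split: if_splits)
  qed (rule A(2))
  ultimately show "2 \<in> A \<or> last_index r \<in> A"
    by blast
next
  assume *: "2 \<in> A \<or> last_index r \<in> A"
  obtain v where v: "alpha v r \<in> subclassC r A" "has_pattern v r A"
    using assms(4) by (auto simp: subclassC_def)
  have "2 \<in> \<I> r" "last_index r \<in> \<I> r"
    by (auto simp: index_set_def last_index_def)
  then have "dcoeff v r 2 \<noteq> 0 \<or> dcoeff v r (last_index r) \<noteq> 0"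
    using v(2) * by (auto simp: has_pattern_def)
  then show "\<not> subclassC r A \<subseteq> \<C> 0"
    using v(1) alpha_in_C0_imp[OF r] by blast
qed

section \<open>Explicit parameters for every pattern that occurs\<close>

lemmas witness_simps = admissible_def has_pattern_def index_set_def dcoeff_simps p1_def p2_def p3_def p4_def
  power2_eq_square power3_eq_cube

text \<open>If b_2 = 0 then p_1 = -4 r^2 b_1^2, so b_1 decides d_1; otherwise p_1 = 0 is linear in
  b_0. As p_2, p_3, p_4 share the s_1-coefficient 8r^2, d_2 is at most linear in s_1.\<close>

lemma subclassC_one_witnesses:
  shows "subclassC 1 {0,1,2,4} \<noteq> {}"
    and "subclassC 1 {1,2,4} \<noteq> {}"
    and "subclassC 1 {0,2,4} \<noteq> {}"
    and "subclassC 1 {0,1,4} \<noteq> {}"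
    and "subclassC 1 {0,1,2} \<noteq> {}"
    and "subclassC 1 {2,4} \<noteq> {}"
    and "subclassC 1 {1,4} \<noteq> {}"
    and "subclassC 1 {0,4} \<noteq> {}"
    and "subclassC 1 {1,2} \<noteq> {}"
    and "subclassC 1 {0,2} \<noteq> {}"
    and "subclassC 1 {2} \<noteq> {}"
    and "subclassC 1 {4} \<noteq> {}"
proof -
  show "subclassC 1 {0,1,2,4} \<noteq> {}"
    by (rule subclassC_nonempty[of _ "Params 0 0 1 1 0"]) (simp_all add: witness_simps)
  show "subclassC 1 {1,2,4} \<noteq> {}"
    by (rule subclassC_nonempty[of _ "Params 0 1 0 1 0"]) (simp_all add: witness_simps)
  show "subclassC 1 {0,2,4} \<noteq> {}"
    \<comment> \<open>With the other entries fixed, p_1 = 16 b_0 - 4.\<close>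
    by (rule subclassC_nonempty[of _ "Params (1/4) 0 2 0 2"]) (simp_all add: witness_simps)
  show "subclassC 1 {0,1,4} \<noteq> {}"
    by (rule subclassC_nonempty[of _ "Params 0 1 2 (-1) 3"]) (simp_all add: witness_simps)
  show "subclassC 1 {0,1,2} \<noteq> {}"
    by (rule subclassC_nonempty[of _ "Params 0 (-1) 2 (-1) 0"]) (simp_all add: witness_simps)
  show "subclassC 1 {2,4} \<noteq> {}"
    by (rule subclassC_nonempty[of _ "Params 1 0 0 1 0"]) (simp_all add: witness_simps)
  show "subclassC 1 {1,4} \<noteq> {}"
    by (rule subclassC_nonempty[of _ "Params 3 2 0 1 0"]) (simp_all add: witness_simps)
  show "subclassC 1 {0,4} \<noteq> {}"
    by (rule subclassC_nonempty[of _ "Params 0 3 2 1 0"]) (simp_all add: witness_simps)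
  show "subclassC 1 {1,2} \<noteq> {}"
    by (rule subclassC_nonempty[of _ "Params 0 4 0 1 0"]) (simp_all add: witness_simps)
  show "subclassC 1 {0,2} \<noteq> {}"
    by (rule subclassC_nonempty[of _ "Params 1 (-1) 2 0 3"]) (simp_all add: witness_simps)
  show "subclassC 1 {2} \<noteq> {}"
    by (rule subclassC_nonempty[of _ "Params 1 0 0 0 1"]) (simp_all add: witness_simps)
  show "subclassC 1 {4} \<noteq> {}"
    by (rule subclassC_nonempty[of _ "Params 0 0 0 1 0"]) (simp_all add: witness_simps)
qed

text \<open>Unlike at r = 1, admissible parameters can satisfy p_4 = 0 and p_2 p_3 = 0 together,
  which gives the last three patterns.\<close>

lemma subclassC_half_witnesses:
  shows "subclassC (1/2) {0,1,2,3} \<noteq> {}"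
    and "subclassC (1/2) {1,2,3} \<noteq> {}"
    and "subclassC (1/2) {0,2,3} \<noteq> {}"
    and "subclassC (1/2) {0,1,3} \<noteq> {}"
    and "subclassC (1/2) {0,1,2} \<noteq> {}"
    and "subclassC (1/2) {2,3} \<noteq> {}"
    and "subclassC (1/2) {1,3} \<noteq> {}"
    and "subclassC (1/2) {0,3} \<noteq> {}"
    and "subclassC (1/2) {1,2} \<noteq> {}"
    and "subclassC (1/2) {0,2} \<noteq> {}"
    and "subclassC (1/2) {2} \<noteq> {}"
    and "subclassC (1/2) {3} \<noteq> {}"
    and "subclassC (1/2) {0} \<noteq> {}"
    and "subclassC (1/2) {1} \<noteq> {}"
    and "subclassC (1/2) {0,1} \<noteq> {}"
proof -
  show "subclassC (1/2) {0,1,2,3} \<noteq> {}"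
    by (rule subclassC_nonempty[of _ "Params 0 0 1 1 0"]) (simp_all add: witness_simps)
  show "subclassC (1/2) {1,2,3} \<noteq> {}"
    by (rule subclassC_nonempty[of _ "Params 0 1 0 1 0"]) (simp_all add: witness_simps)
  show "subclassC (1/2) {0,2,3} \<noteq> {}"
    by (rule subclassC_nonempty[of _ "Params (-1/4) 0 2 0 3"]) (simp_all add: witness_simps)
  show "subclassC (1/2) {0,1,3} \<noteq> {}"
    by (rule subclassC_nonempty[of _ "Params 0 3 2 (-1) 0"]) (simp_all add: witness_simps)
  show "subclassC (1/2) {0,1,2} \<noteq> {}"
    by (rule subclassC_nonempty[of _ "Params 0 (-1) 2 (-1) 1"]) (simp_all add: witness_simps)
  show "subclassC (1/2) {2,3} \<noteq> {}"
    by (rule subclassC_nonempty[of _ "Params 0 0 0 1 1"]) (simp_all add: witness_simps)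
  show "subclassC (1/2) {1,3} \<noteq> {}"
    by (rule subclassC_nonempty[of _ "Params 0 4 0 1 (-3)"]) (simp_all add: witness_simps)
  show "subclassC (1/2) {0,3} \<noteq> {}"
    \<comment> \<open>Given b_1 = 3, b_2 = 1, s_2 = 0, p_1 = 0 forces b_0 = 11/8; then d_2 = 0 is
      linear in s_1 with root -39/256.\<close>
    by (rule subclassC_nonempty[of _ "Params (11/8) 3 1 (-39/256) 0"]) (simp_all add: witness_simps)
  show "subclassC (1/2) {1,2} \<noteq> {}"
    by (rule subclassC_nonempty[of _ "Params 1 2 0 1 2"]) (simp_all add: witness_simps)
  show "subclassC (1/2) {0,2} \<noteq> {}"
    by (rule subclassC_nonempty[of _ "Params 2 2 4 1 3"]) (simp_all add: witness_simps)
  show "subclassC (1/2) {2} \<noteq> {}"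
    by (rule subclassC_nonempty[of _ "Params 0 0 0 1 2"]) (simp_all add: witness_simps)
  show "subclassC (1/2) {3} \<noteq> {}"
    by (rule subclassC_nonempty[of _ "Params 0 0 0 1 0"]) (simp_all add: witness_simps)
  show "subclassC (1/2) {0} \<noteq> {}"
    by (rule subclassC_nonempty[of _ "Params 0 6 4 1 2"]) (simp_all add: witness_simps)
  show "subclassC (1/2) {1} \<noteq> {}"
    by (rule subclassC_nonempty[of _ "Params 0 4 0 1 (-1)"]) (simp_all add: witness_simps)
  show "subclassC (1/2) {0,1} \<noteq> {}"
    by (rule subclassC_nonempty[of _ "Params (-1) (-1) 2 (-2) 0"]) (simp_all add: witness_simps)
qed

lemma subclassC_third_witnesses:
  shows "subclassC (1/3) {0,1,2,4} \<noteq> {}"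
    and "subclassC (1/3) {1,2,4} \<noteq> {}"
    and "subclassC (1/3) {0,2,4} \<noteq> {}"
    and "subclassC (1/3) {0,1,4} \<noteq> {}"
    and "subclassC (1/3) {0,1,2} \<noteq> {}"
    and "subclassC (1/3) {2,4} \<noteq> {}"
    and "subclassC (1/3) {1,4} \<noteq> {}"
    and "subclassC (1/3) {0,4} \<noteq> {}"
    and "subclassC (1/3) {1,2} \<noteq> {}"
    and "subclassC (1/3) {0,2} \<noteq> {}"
    and "subclassC (1/3) {2} \<noteq> {}"
    and "subclassC (1/3) {4} \<noteq> {}"
    and "subclassC (1/3) {0} \<noteq> {}"
    and "subclassC (1/3) {1} \<noteq> {}"
    and "subclassC (1/3) {0,1} \<noteq> {}"
proof -
  show "subclassC (1/3) {0,1,2,4} \<noteq> {}"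
    by (rule subclassC_nonempty[of _ "Params 0 0 1 1 0"]) (simp_all add: witness_simps)
  show "subclassC (1/3) {1,2,4} \<noteq> {}"
    by (rule subclassC_nonempty[of _ "Params 0 1 0 1 0"]) (simp_all add: witness_simps)
  show "subclassC (1/3) {0,2,4} \<noteq> {}"
    by (rule subclassC_nonempty[of _ "Params (1/4) 2 2 0 2"]) (simp_all add: witness_simps)
  show "subclassC (1/3) {0,1,4} \<noteq> {}"
    by (rule subclassC_nonempty[of _ "Params 0 3 2 1 3"]) (simp_all add: witness_simps)
  show "subclassC (1/3) {0,1,2} \<noteq> {}"
    by (rule subclassC_nonempty[of _ "Params 0 1 2 (-3) 0"]) (simp_all add: witness_simps)
  show "subclassC (1/3) {2,4} \<noteq> {}"
    by (rule subclassC_nonempty[of _ "Params 0 0 0 1 1"]) (simp_all add: witness_simps)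
  show "subclassC (1/3) {1,4} \<noteq> {}"
    by (rule subclassC_nonempty[of _ "Params 1 2 0 0 (-2)"]) (simp_all add: witness_simps)
  show "subclassC (1/3) {0,4} \<noteq> {}"
    by (rule subclassC_nonempty[of _ "Params 1 5 2 0 1"]) (simp_all add: witness_simps)
  show "subclassC (1/3) {1,2} \<noteq> {}"
    by (rule subclassC_nonempty[of _ "Params 1 (-2) 0 1 2"]) (simp_all add: witness_simps)
  show "subclassC (1/3) {0,2} \<noteq> {}"
    by (rule subclassC_nonempty[of _ "Params 2 1 2 (-1) 2"]) (simp_all add: witness_simps)
  show "subclassC (1/3) {2} \<noteq> {}"
    by (rule subclassC_nonempty[of _ "Params 1 0 0 1 1"]) (simp_all add: witness_simps)
  show "subclassC (1/3) {4} \<noteq> {}"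
    by (rule subclassC_nonempty[of _ "Params 0 0 0 1 0"]) (simp_all add: witness_simps)
  show "subclassC (1/3) {0} \<noteq> {}"
    by (rule subclassC_nonempty[of _ "Params 2 3 2 (-1) 1"]) (simp_all add: witness_simps)
  show "subclassC (1/3) {1} \<noteq> {}"
    by (rule subclassC_nonempty[of _ "Params 1 2 0 1 0"]) (simp_all add: witness_simps)
  show "subclassC (1/3) {0,1} \<noteq> {}"
    by (rule subclassC_nonempty[of _ "Params (-1) 1 2 (-1) 1"]) (simp_all add: witness_simps)
qed

lemma subclassC_half_nonempty:
  assumes "A \<subseteq> \<I> (1/2)" "A \<noteq> {}"
  shows "subclassC (1/2) A \<noteq> {}"
  using nonempty_subset_cases[of 3 A] assms subclassC_half_witnesses by (auto simp: index_set_def)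

lemma subclassC_third_nonempty:
  assumes "A \<subseteq> \<I> (1/3)" "A \<noteq> {}"
  shows "subclassC (1/3) A \<noteq> {}"
  using nonempty_subset_cases[of 4 A] assms subclassC_third_witnesses by (auto simp: index_set_def)

theorem mainTheorem2:
  shows "(\<forall>r\<in>{1, 1/2, 1/3}. \<forall>A B. A \<subseteq> \<I> r \<and> A \<noteq> {} \<and> B \<subseteq> \<I> r \<and> B \<noteq> {} \<and> A \<noteq> B \<longrightarrow>
      subclassC r A \<inter> subclassC r B = {})
    \<and> {A. A \<subseteq> \<I> 1 \<and> A \<noteq> {} \<and> subclassC 1 A \<noteq> {}} =
      {{0,1,2,4}, {1,2,4}, {0,2,4}, {0,1,4}, {0,1,2}, {2,4}, {1,4}, {0,4}, {1,2}, {0,2}, {2}, {4}}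
    \<and> (\<forall>A\<in>{{0}, {1}, {0,1}}. \<forall>v. has_pattern v 1 A \<longrightarrow> has_value_at (alpha v 1) 1 0)
    \<and> (\<forall>A. A \<subseteq> \<I> (1/3) \<and> A \<noteq> {} \<longrightarrow> subclassC (1/3) A \<noteq> {})
    \<and> (\<forall>A\<in>{{0}, {1}, {0,1}}. subclassC (1/3) A \<subseteq> \<C> 0)
    \<and> {A. A \<subseteq> \<I> (1/3) \<and> A \<noteq> {} \<and> \<not> subclassC (1/3) A \<subseteq> \<C> 0} =
      {{0,1,2,4}, {1,2,4}, {0,2,4}, {0,1,4}, {0,1,2}, {2,4}, {1,4}, {0,4}, {1,2}, {0,2}, {2}, {4}}
    \<and> (\<forall>A. A \<subseteq> \<I> (1/2) \<and> A \<noteq> {} \<longrightarrow> subclassC (1/2) A \<noteq> {})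
    \<and> (\<forall>A\<in>{{0}, {1}, {0,1}}. subclassC (1/2) A \<subseteq> \<C> 0)
    \<and> {A. A \<subseteq> \<I> (1/2) \<and> A \<noteq> {} \<and> \<not> subclassC (1/2) A \<subseteq> \<C> 0} =
      {{0,1,2,3}, {1,2,3}, {0,2,3}, {0,1,3}, {0,1,2}, {2,3}, {1,3}, {0,3}, {1,2}, {0,2}, {2}, {3}}"
proof (intro conjI)
  show "\<forall>r\<in>{1, 1/2, 1/3}. \<forall>A B. A \<subseteq> \<I> r \<and> A \<noteq> {} \<and> B \<subseteq> \<I> r \<and> B \<noteq> {} \<and> A \<noteq> B \<longrightarrow>
      subclassC r A \<inter> subclassC r B = {}"
    using subclassC_disjoint by blast
  show "{A. A \<subseteq> \<I> 1 \<and> A \<noteq> {} \<and> subclassC 1 A \<noteq> {}} =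
      {{0,1,2,4}, {1,2,4}, {0,2,4}, {0,1,4}, {0,1,2}, {2,4}, {1,4}, {0,4}, {1,2}, {0,2}, {2}, {4}}"
      (is "?L = ?R")
  proof
    have "?L \<subseteq> {A. A \<subseteq> {0, 1, 2, 4} \<and> (2 \<in> A \<or> 4 \<in> A)}"
      using subclassC_1_imp by (auto simp: index_set_def)
    then show "?L \<subseteq> ?R"
      by (subst (asm) subsets_of_index_set) simp_all
    show "?R \<subseteq> ?L"
      using subclassC_one_witnesses by (auto simp: index_set_def)
  qed
  show "\<forall>A\<in>{{0}, {1}, {0,1}}. \<forall>v. has_pattern v 1 A \<longrightarrow> has_value_at (alpha v 1) 1 0"
    using alpha_vanishes_at_1 by blast
  show "\<forall>A. A \<subseteq> \<I> (1/3) \<and> A \<noteq> {} \<longrightarrow> subclassC (1/3) A \<noteq> {}"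
    using subclassC_third_nonempty by blast
  show "\<forall>A\<in>{{0}, {1}, {0,1}}. subclassC (1/3) A \<subseteq> \<C> 0"
    using subclassC_subset_C0[of "1/3"] by blast
  \<comment> \<open>All classes being nonempty, the pattern alone decides containment in
    C_0.\<close>
  have "{A. A \<subseteq> \<I> (1/3) \<and> A \<noteq> {} \<and> \<not> subclassC (1/3) A \<subseteq> \<C> 0} =
      {A. A \<subseteq> {0, 1, 2, 4} \<and> (2 \<in> A \<or> 4 \<in> A)}"
    using subclassC_not_subset_C0_iff[of "1/3"] subclassC_third_nonempty
    by (auto simp: index_set_def last_index_def)
  then show "{A. A \<subseteq> \<I> (1/3) \<and> A \<noteq> {} \<and> \<not> subclassC (1/3) A \<subseteq> \<C> 0} =
      {{0,1,2,4}, {1,2,4}, {0,2,4}, {0,1,4}, {0,1,2}, {2,4}, {1,4}, {0,4}, {1,2}, {0,2}, {2}, {4}}"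
    by (subst (asm) subsets_of_index_set) simp_all
  show "\<forall>A. A \<subseteq> \<I> (1/2) \<and> A \<noteq> {} \<longrightarrow> subclassC (1/2) A \<noteq> {}"
    using subclassC_half_nonempty by blast
  show "\<forall>A\<in>{{0}, {1}, {0,1}}. subclassC (1/2) A \<subseteq> \<C> 0"
    using subclassC_subset_C0[of "1/2"] by blast
  have "{A. A \<subseteq> \<I> (1/2) \<and> A \<noteq> {} \<and> \<not> subclassC (1/2) A \<subseteq> \<C> 0} =
      {A. A \<subseteq> {0, 1, 2, 3} \<and> (2 \<in> A \<or> 3 \<in> A)}"
    using subclassC_not_subset_C0_iff[of "1/2"] subclassC_half_nonempty
    by (auto simp: index_set_def last_index_def)
  then show "{A. A \<subseteq> \<I> (1/2) \<and> A \<noteq> {} \<and> \<not> subclassC (1/2) A \<subseteq> \<C> 0} =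
      {{0,1,2,3}, {1,2,3}, {0,2,3}, {0,1,3}, {0,1,2}, {2,3}, {1,3}, {0,3}, {1,2}, {0,2}, {2}, {3}}"
    by (subst (asm) subsets_of_index_set) simp_all
qed

end
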